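(* Let $d,m\ge1$ be integers, let $A=\begin{pmatrix}\bm{\beta}\\ A'\end{pmatrix}\in\mathbb{R}^{(d+1)\times m}$ with $\bm{\beta}\in\mathbb{R}^m$, $A'\in\mathbb{R}^{d\times m}$, let $\bm{\theta}\in\mathbb{R}^{d+m}$, let $\varepsilon>0$, and let $C_{d,m}:=8^d\pi^{2m}$. (a) Suppose that $\omega(A)=\omega$. Then there is a positive constant $Q_0(A,\varepsilon)$ depending only on $A$ and $\varepsilon$ such that for every positive integer $Q\ge Q_0(A,\varepsilon)$ and every $\delta\ge Q^{-\frac1\omega+\varepsilon}$ we have $$N_A(Q,\delta,\bm{\theta})\le C_{d+1,m}\,\delta^mQ^{d+1}.$$ Or equivalently, there is a positive constant $C(A,\varepsilon)$ depending only on $A$ and $\varepsilon$ such that for every $\delta>0$ and every positive integer $Q$ $$N_A(Q,\delta,\bm{\theta})\le\max\left\{C_{d+1,m}\,\delta^mQ^{d+1},\ C(A,\varepsilon)\,Q^{d+1-\frac{m}{\omega}+\varepsilon}\right\}.$$ (b) Suppose that $\omega(A')=\omega$. Then there is a positive constant $Q_0(A',\varepsilon)$ depending only on $A'$ and $\varepsilon$ such that for every positive integer $Q\ge Q_0(A',\varepsilon)$ and every $\delta\ge Q^{-\frac1\omega+\varepsilon}$ we have $$N_A'(Q,\delta,\bm{\theta})\le C_{d,m}\,\delta^mQ^{d}.$$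
   Context: Vectors are row vectors; $|\cdot|$ is the supremum norm; $\|\bm{y}\|$ is the sup-norm distance of $\bm{y}$ to the nearest integer vector (also for column vectors). The diophantine exponent $\omega(B)$ of a real matrix $B$ with $m$ columns is the supremum (possibly $\infty$, with $1/\infty=0$) of all $\omega\in\mathbb{R}$ such that $\|B\bm{q}^{\mathrm T}\|<|\bm{q}|^{-\omega}$ holds for infinitely many $\bm{q}\in\mathbb{Z}^m$. Write $\bm{\theta}=(\bm{\theta}^{(1)},\bm{\theta}^{(2)})\in\mathbb{R}^d\times\mathbb{R}^m$. The counting functions are $$N_A(Q,\delta,\bm{\theta})=\#\{(q,\bm{a})\in\mathbb{Z}\times\mathbb{Z}^{d}: \|(q,\bm{a}+\bm{\theta}^{(1)})A-\bm{\theta}^{(2)}\|<\delta,\ |(q,\bm{a})|<Q\},$$ $$N_A'(Q,\delta,\bm{\theta})=\sup_{q\in\mathbb{R}}\#\{\bm{a}\in\mathbb{Z}^d:\|(q,\bm{a}+\bm{\theta}^{(1)})A-\bm{\theta}^{(2)}\|<\delta,\ |\bm{a}|<Q\}.$$ *)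

theory Defs
  imports "HOL-Analysis.Analysis"
begin

definition of_int_vec :: "int ^ 'n \<Rightarrow> real ^ 'n"
  where "of_int_vec z = (\<chi> i. real_of_int (z $ i))"

(* The sup-norm is infnorm. The infimum is attained, since each coordinate has a nearest integer. *)
definition int_dist :: "real ^ 'n \<Rightarrow> real"
  where "int_dist y = (INF z. infnorm (y - of_int_vec z))"

(* Extended-real valued, so that the supremum may be \<infinity>; ereal division gives x / \<infinity> = 0.
   The vector q = 0 is never counted (0 powr x = 0), which is immaterial for infinitude. *)
definition dioph_exponent :: "real ^ 'm ^ 'n \<Rightarrow> ereal"
  where "dioph_exponent B =
    Sup {ereal w | w :: real.
      infinite {q :: int ^ 'm. int_dist (B *v of_int_vec q) < infnorm (of_int_vec q) powr (- w)}}"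

(* A (d+1)-dimensional index type is 'd option: None is the first coordinate and Some i the
   i-th of the remaining d. For a row vector this is (x, v); with 'a a type of row vectors it
   is the matrix with first row x followed by the rows of v. *)
definition vec_cons :: "'a \<Rightarrow> 'a ^ 'd \<Rightarrow> 'a ^ ('d option)"
  where "vec_cons x v = (\<chi> i. case i of None \<Rightarrow> x | Some j \<Rightarrow> v $ j)"

definition count_N ::
    "real ^ 'm ^ ('d option) \<Rightarrow> nat \<Rightarrow> real \<Rightarrow> (real ^ 'd) \<times> (real ^ 'm) \<Rightarrow> nat"
  where "count_N A Q \<delta> \<theta> =
    card {(q :: int, a :: int ^ 'd).
      int_dist (vec_cons (real_of_int q) (of_int_vec a + fst \<theta>) v* A - snd \<theta>) < \<delta>
      \<and> infnorm (of_int_vec (vec_cons q a)) < real Q}"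

(* The cardinalities are bounded uniformly in q by the number of a with infnorm a < Q,
   so this is a genuine supremum. *)
definition count_N' ::
    "real ^ 'm ^ ('d option) \<Rightarrow> nat \<Rightarrow> real \<Rightarrow> (real ^ 'd) \<times> (real ^ 'm) \<Rightarrow> nat"
  where "count_N' A Q \<delta> \<theta> =
    (SUP q :: real. card {a :: int ^ 'd.
      int_dist (vec_cons q (of_int_vec a + fst \<theta>) v* A - snd \<theta>) < \<delta>
      \<and> infnorm (of_int_vec a) < real Q})"

definition C_const :: "nat \<Rightarrow> nat \<Rightarrow> real"
  where "C_const d m = 8 ^ d * pi ^ (2 * m)"

end

theory Submission
  imports Defs
begin

text \<open>
  Fix a matrix \<open>A\<close> with \<open>n\<close> rows and \<open>m\<close> columns. Both counting functions come down to the number \<open>N\<close>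
  of integer points \<open>x\<close> with \<open>|x| < Q\<close> for which \<open>x A\<close> lies within \<open>\<delta>\<close> of a prescribed point \<open>\<eta>\<close> modulo
  the integers; the shift \<open>\<theta>\<close>, and in part (b) the real parameter \<open>q\<close>, only move \<open>\<eta>\<close>, so the
  estimate has to be uniform in \<open>\<eta>\<close>.

  The estimate is a duality (large sieve) argument. Write \<open>e(s)\<close> for \<open>exp(2 \<pi> i s)\<close> and put
  \<open>D_H(t) = \<Sum> e(t \<bullet> u)\<close>, where \<open>u\<close> runs over the integer vectors with entries in \<open>[0, H)\<close>. If
  \<open>2 H \<delta> \<le> 1\<close> and \<open>x\<close> is counted, then \<open>|D_H(x A - \<eta>)| \<ge> (2 H / \<pi>)^m\<close>, because in each coordinate
  the phases of the terms stay within half a turn and cannot cancel (\<open>norm_box_sum_lower\<close>). Every \<open>x\<close> with \<open>|x| < Q\<close>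
  is a difference \<open>y - z\<close> of points of the cube \<open>[0, 2 Q)^n\<close> in at least \<open>Q^n\<close> ways
  (\<open>sum_le_sum_differences\<close>). Expanding squares and exchanging the order of summation
  (\<open>box_sum_duality\<close>) therefore gives
  \<open>Q^n N (2 H / \<pi>)^{2 m} \<le> \<Sum>_{y, z} |D_H((y - z) A - \<eta>)|^2 \<le> \<Sum>_{u, v} |D_{2 Q}(A (u - v))|^2\<close>,
  with \<open>y, z\<close> in \<open>[0, 2 Q)^n\<close> and \<open>u, v\<close> in \<open>[0, H)^m\<close>.

  Suppose now that \<open>A q\<close> is at distance at least \<open>1 / Q\<close> from the integers whenever \<open>0 < |q| < H\<close>. Then
  for each \<open>u\<close> the points \<open>A (u - v)\<close> are \<open>1 / Q\<close>-separated on the torus, and since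
  \<open>|D_{2 Q}|^2\<close> is a product of factors, one for each coordinate, that are at most \<open>(2 Q)^2\<close> and decay
  quadratically away from the integers, the sum over \<open>v\<close>
  is at most \<open>(8 Q^2)^n\<close> (\<open>separated_box_sum_le\<close>). Hence \<open>N \<le> (8 Q)^n (\<pi>^2 / (4 H))^m\<close>
  (\<open>card_near_le\<close>), which is the bound with the constant \<open>8^n \<pi>^{2 m}\<close> when \<open>H\<close> is the integer part of
  \<open>1 / (2 \<delta>)\<close>.

  The separation is what the diophantine exponent \<open>\<omega>\<close> provides. For \<open>w > \<omega>\<close> the distance of \<open>A q\<close> to the
  integers is at least \<open>|q|^{-w}\<close> apart from finitely many \<open>q\<close>, for which it is bounded below by a
  positive constant (\<open>int_dist_lower_bound\<close>); with \<open>|q| < H \<le> Q^{1/\<omega> - \<epsilon>}\<close> and \<open>w\<close> close to \<open>\<omega>\<close> this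
  is at least \<open>1 / Q\<close>. The second bound of part (a) follows from the first by monotonicity in
  \<open>\<delta>\<close>, with \<open>\<epsilon> / m\<close> in place of \<open>\<epsilon>\<close>.
\<close>

section \<open>Integer vectors and the supremum norm\<close>

definition cube :: "nat \<Rightarrow> (int ^ 'n) set"
  where "cube R = {y. \<forall>i. y $ i \<in> {0..<int R}}"

text \<open>Expanding a product of sums yields a sum over all vectors of choices. This turns exponential
  sums over cubes into products of one-dimensional ones.\<close>

lemma sum_prod_vec:
  fixes f :: "'n::finite \<Rightarrow> 'b \<Rightarrow> 'a::comm_semiring_1"
  assumes "finite B"
  shows "(\<Sum>y\<in>{y :: 'b ^ 'n. \<forall>i. y $ i \<in> B}. \<Prod>i\<in>UNIV. f i (y $ i)) = (\<Prod>i\<in>UNIV. \<Sum>k\<in>B. f i k)"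
proof -
  have "(\<Prod>i\<in>UNIV. \<Sum>k\<in>B. f i k) = (\<Sum>g\<in>PiE UNIV (\<lambda>_. B). \<Prod>i\<in>UNIV. f i (g i))"
    by (rule prod_sum_PiE) (use assms in auto)
  also have "\<dots> = (\<Sum>y\<in>{y :: 'b ^ 'n. \<forall>i. y $ i \<in> B}. \<Prod>i\<in>UNIV. f i (y $ i))"
    by (rule sum.reindex_bij_witness[where i = "vec_nth" and j = "vec_lambda"]) auto
  finally show ?thesis ..
qed

lemma
  fixes B :: "'b set"
  assumes "finite B"
  shows finite_vec: "finite {y :: 'b ^ 'n. \<forall>i. y $ i \<in> B}"
    and card_vec: "card {y :: 'b ^ 'n. \<forall>i. y $ i \<in> B} = card B ^ CARD('n)"
proof -
  have "{y :: 'b ^ 'n. \<forall>i. y $ i \<in> B} = vec_lambda ` PiE UNIV (\<lambda>_. B)"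
    by (auto simp: image_iff intro!: bexI[where x = "vec_nth _"])
  then show "finite {y :: 'b ^ 'n. \<forall>i. y $ i \<in> B}"
    using assms by (simp add: finite_PiE)
  show "card {y :: 'b ^ 'n. \<forall>i. y $ i \<in> B} = card B ^ CARD('n)"
    using sum_prod_vec[OF assms, where f = "\<lambda>_ _. 1 :: nat" and 'n = 'n] by simp
qed

lemma finite_cube [simp]: "finite (cube R :: (int ^ 'n) set)"
  unfolding cube_def by (rule finite_vec) simp

lemma card_cube [simp]: "card (cube R :: (int ^ 'n) set) = R ^ CARD('n)"
  unfolding cube_def by (subst card_vec) simp_all

lemma of_int_vec_nth [simp]: "of_int_vec x $ i = of_int (x $ i)"
  by (simp add: of_int_vec_def)

lemma of_int_vec_diff: "of_int_vec (x - y) = of_int_vec x - of_int_vec y"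
  by (simp add: vec_eq_iff)

lemma infnorm_less_iff:
  fixes x :: "real ^ 'n"
  shows "infnorm x < c \<longleftrightarrow> (\<forall>i. \<bar>x $ i\<bar> < c)"
proof -
  have *: "{\<bar>x $ i\<bar> |i. i \<in> UNIV} = range (\<lambda>i. \<bar>x $ i\<bar>)" by auto
  show ?thesis
    unfolding infnorm_cart * by (subst cSup_eq_Max) (auto simp: Max_less_iff)
qed

lemma int_dist_less_iff:
  "int_dist y < c \<longleftrightarrow> (\<exists>z. infnorm (y - of_int_vec z) < c)"
  unfolding int_dist_def
  by (subst cINF_less_iff) (auto intro!: bdd_belowI2[where m = 0] infnorm_pos_le)

lemma int_dist_le: "int_dist y \<le> infnorm (y - of_int_vec z)"
  using int_dist_less_iff[of y] by (meson leI less_irrefl)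

section \<open>Exponential sums over intervals and cubes\<close>

definition exp_sum :: "nat \<Rightarrow> real \<Rightarrow> complex"
  where "exp_sum R t = (\<Sum>k\<in>{0..<int R}. cis (2 * pi * (t * of_int k)))"

definition box_sum :: "nat \<Rightarrow> real ^ 'n \<Rightarrow> complex"
  where "box_sum R t = (\<Sum>y\<in>cube R. cis (2 * pi * (t \<bullet> of_int_vec y)))"

lemma box_sum_eq_prod: "box_sum R (t :: real ^ 'n) = (\<Prod>i\<in>UNIV. exp_sum R (t $ i))"
proof -
  have cis_sum: "cis (sum g A) = (\<Prod>i\<in>A. cis (g i))" if "finite A" for A :: "'n set" and g
    using that by (induction A) (auto simp: cis_mult[symmetric])
  have "(\<Prod>i\<in>UNIV. exp_sum R (t $ i))
      = (\<Sum>y\<in>cube R. \<Prod>i\<in>UNIV. cis (2 * pi * (t $ i * of_int (y $ i))))"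
    unfolding exp_sum_def cube_def by (rule sum_prod_vec[symmetric]) simp
  also have "\<dots> = box_sum R t"
    unfolding box_sum_def
    by (intro sum.cong refl, subst cis_sum[symmetric])
       (auto simp: inner_vec_def sum_distrib_left)
  finally show ?thesis ..
qed

text \<open>Exponential sums are functions on the torus, so points may be reduced modulo the integers.\<close>

lemma exp_sum_shift: "exp_sum R (t - of_int z) = exp_sum R t"
proof -
  have "cis (2 * pi * ((t - of_int z) * of_int k)) = cis (2 * pi * (t * of_int k))" for k
  proof -
    have "2 * pi * ((t - of_int z) * of_int k) = 2 * pi * (t * of_int k) + 2 * pi * of_int (- (z * k))"
      by (simp add: algebra_simps)
    then show ?thesis
      by (simp only: cis_mult[symmetric] cis_multiple_2pi[OF Ints_of_int]) simp
  qed
  then show ?thesis by (simp add: exp_sum_def)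
qed

lemma norm_exp_sum_le: "norm (exp_sum R t) \<le> R"
  unfolding exp_sum_def by (rule order.trans[OF norm_sum]) simp

text \<open>The geometric sum formula in absolute values, using that the chord from \<open>1\<close> to \<open>e(s)\<close> has length
  \<open>2 |sin (\<pi> s)|\<close>. The form without division also covers integral \<open>t\<close>.\<close>

lemma norm_exp_sum_sin: "norm (exp_sum R t) * \<bar>sin (pi * t)\<bar> = \<bar>sin (pi * (R * t))\<bar>"
proof -
  have chord: "norm (1 - cis (2 * pi * s)) = 2 * \<bar>sin (pi * s)\<bar>" for s
  proof -
    have "(norm (1 - cis (2 * pi * s)))\<^sup>2 = (1 - cos (2 * (pi * s)))\<^sup>2 + (sin (2 * (pi * s)))\<^sup>2"
      by (simp add: cmod_power2 mult.assoc)
    also have "\<dots> = 2 - 2 * cos (2 * (pi * s))"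
      using sin_cos_squared_add[of "2 * (pi * s)"] by (simp add: power2_eq_square algebra_simps)
    also have "\<dots> = (2 * \<bar>sin (pi * s)\<bar>)\<^sup>2"
      by (simp add: cos_double_sin)
    finally show ?thesis
      by (rule power2_eq_imp_eq) auto
  qed
  have "exp_sum R t = (\<Sum>k<R. cis (2 * pi * (t * real k)))"
    unfolding exp_sum_def
    by (rule sum.reindex_bij_witness[where i = int and j = nat]) auto
  also have "\<dots> = (\<Sum>k<R. cis (2 * pi * t) ^ k)"
    by (intro sum.cong refl, subst Complex.DeMoivre) (simp add: mult_ac)
  finally have geometric: "exp_sum R t = (\<Sum>k<R. cis (2 * pi * t) ^ k)" .
  have "cis (2 * pi * t) ^ R = cis (2 * pi * (R * t))"
    by (subst Complex.DeMoivre) (simp add: mult_ac)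
  then have "(1 - cis (2 * pi * t)) * exp_sum R t = 1 - cis (2 * pi * (R * t))"
    using one_diff_power_eq[of "cis (2 * pi * t)" R] geometric by simp
  then have "norm (1 - cis (2 * pi * t)) * norm (exp_sum R t) = norm (1 - cis (2 * pi * (R * t)))"
    by (metis norm_mult)
  then show ?thesis by (simp add: chord mult.commute[of "norm (exp_sum R t)"])
qed

text \<open>Jordan's inequality: the sine is concave on \<open>[0, \<pi> / 2]\<close> and so lies above its chord.\<close>

lemma jordan_sin:
  assumes "\<bar>x\<bar> \<le> 1 / 2"
  shows "2 * \<bar>x\<bar> \<le> \<bar>sin (pi * x)\<bar>"
proof -
  have conv: "convex_on {0..pi/2} (\<lambda>x. - sin x)"
    by (rule f''_ge0_imp_convex[where f' = "\<lambda>x. - cos x" and f'' = sin])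
       (auto intro!: derivative_eq_intros sin_ge_zero)
  have *: "2 * y \<le> sin (pi * y)" if "0 \<le> y" "y \<le> 1 / 2" for y
  proof -
    have "- sin ((1 - 2 * y) *\<^sub>R 0 + (2 * y) *\<^sub>R (pi / 2)) \<le> (1 - 2 * y) * - sin 0 + 2 * y * - sin (pi / 2)"
      by (rule convex_onD[OF conv]) (use that in auto)
    then show ?thesis by (simp add: mult.commute)
  qed
  show ?thesis
    using *[of x] *[of "- x"] assms by (cases "x \<ge> 0") (auto simp: abs_if split: if_splits)
qed

lemma norm_exp_sum_upper:
  assumes "\<bar>t\<bar> \<le> 1 / 2" "t \<noteq> 0"
  shows "norm (exp_sum R t) \<le> 1 / (2 * \<bar>t\<bar>)"
proof -
  have "norm (exp_sum R t) * (2 * \<bar>t\<bar>) \<le> norm (exp_sum R t) * \<bar>sin (pi * t)\<bar>"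
    by (intro mult_left_mono jordan_sin assms) simp
  also have "\<dots> \<le> 1" by (simp add: norm_exp_sum_sin)
  finally show ?thesis using assms by (simp add: field_simps)
qed

text \<open>The numerator of the geometric sum formula is bounded below by Jordan's inequality, the
  denominator above by \<open>|sin x| \<le> |x|\<close>.\<close>

lemma norm_exp_sum_lower:
  assumes "2 * real R * \<bar>t\<bar> \<le> 1"
  shows "2 * real R / pi \<le> norm (exp_sum R t)"
proof (cases "t = 0 \<or> R = 0")
  case True
  then show ?thesis
    using mult_left_mono[OF pi_ge_two, of "real R"] by (auto simp: exp_sum_def field_simps)
next
  case False
  have "2 * \<bar>R * t\<bar> \<le> norm (exp_sum R t) * \<bar>sin (pi * t)\<bar>"
    unfolding norm_exp_sum_sin by (rule jordan_sin) (use assms in \<open>simp add: abs_mult\<close>)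
  also have "\<dots> \<le> norm (exp_sum R t) * (pi * \<bar>t\<bar>)"
    using abs_sin_x_le_abs_x[of "pi * t"] by (intro mult_left_mono) (auto simp: abs_mult)
  finally show ?thesis using False by (simp add: field_simps abs_mult)
qed

text \<open>Points close to the origin of the torus are detected by a large value of the exponential sum.\<close>

lemma norm_box_sum_lower:
  fixes t :: "real ^ 'm"
  assumes "int_dist t < \<delta>" "2 * real H * \<delta> \<le> 1"
  shows "(2 * real H / pi) ^ CARD('m) \<le> norm (box_sum H t)"
proof -
  obtain z where z: "\<And>i. \<bar>t $ i - of_int (z $ i)\<bar> < \<delta>"
    using assms(1) by (auto simp: int_dist_less_iff infnorm_less_iff)
  have "2 * real H / pi \<le> norm (exp_sum H (t $ i))" for i
  proof -
    have "2 * real H * \<bar>t $ i - of_int (z $ i)\<bar> \<le> 2 * real H * \<delta>"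
      using z[of i] by (intro mult_left_mono) auto
    then show ?thesis
      using norm_exp_sum_lower[of H "t $ i - of_int (z $ i)"] assms(2) by (simp add: exp_sum_shift)
  qed
  then have "(\<Prod>i\<in>(UNIV :: 'm set). 2 * real H / pi) \<le> (\<Prod>i\<in>UNIV. norm (exp_sum H (t $ i)))"
    by (intro prod_mono) auto
  then show ?thesis
    by (simp add: box_sum_eq_prod prod_norm)
qed

text \<open>By telescoping, since \<open>1 / (k + 1)^2 \<le> 1 / k - 1 / (k + 1)\<close>. The cruder value \<open>2\<close> in place of
  \<open>\<pi>^2 / 6\<close> is what produces the base \<open>8\<close> of the final constant.\<close>

lemma sum_inverse_squares_le: "(\<Sum>k=1..n. 1 / real k ^ 2) \<le> 2"
proof (cases "n = 0")
  case False
  then have "0 < n" by simp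
  then have "(\<Sum>k=1..n. 1 / real k ^ 2) \<le> 2 - 1 / n"
  proof (induction n rule: nat_induct_non_zero)
    case (Suc n)
    have "1 / real (Suc n) ^ 2 \<le> 1 / (real n * real (Suc n))"
      using Suc by (intro divide_left_mono) (auto simp: power2_eq_square)
    also have "\<dots> = 1 / n - 1 / Suc n"
      using Suc by (simp add: field_simps)
    finally show ?case using Suc by simp
  qed simp
  then show ?thesis by (rule order.trans) simp
qed simp

section \<open>A large sieve inequality for separated points\<close>

text \<open>
  Reduce the points to \<open>[-1/2, 1/2]^n\<close> and cut the torus into half-open cells of side \<open>1 / Q\<close> centred at the
  multiples of \<open>1 / Q\<close>. By separation each cell contains at most one of the points. On the cell with
  index \<open>k\<close> the square of the exponential sum is at most a product over the coordinates of a weight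
  \<open>g\<close>, equal to \<open>4 Q^2\<close> at \<open>0\<close> and to \<open>Q^2 / k^2\<close> elsewhere. Summing over all cells gives the \<open>n\<close>-th
  power of \<open>\<Sum> g(k) \<le> 4 Q^2 + 2 \<cdot> 2 Q^2 = 8 Q^2\<close>.
\<close>

lemma separated_box_sum_le:
  fixes t :: "'a \<Rightarrow> real ^ 'n"
  assumes S: "finite S" and Q: "Q > 0"
    and sep: "\<And>u v. u \<in> S \<Longrightarrow> v \<in> S \<Longrightarrow> u \<noteq> v \<Longrightarrow> 1 / real Q \<le> int_dist (t u - t v)"
  shows "(\<Sum>u\<in>S. (norm (box_sum (2 * Q) (t u)))\<^sup>2) \<le> (8 * (real Q)\<^sup>2) ^ CARD('n)"
proof -
  define r where "r u i = t u $ i - of_int (round (t u $ i))" for u i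
  define cell :: "'a \<Rightarrow> int ^ 'n" where "cell u = (\<chi> i. round (Q * r u i))" for u
  define g where "g k = (if k = 0 then 4 * (real Q)\<^sup>2 else (real Q)\<^sup>2 / (of_int k)\<^sup>2)" for k :: int
  define B where "B = {- int Q..int Q}"
  have r_le: "\<bar>r u i\<bar> \<le> 1 / 2" for u i
    unfolding r_def using of_int_round_abs_le[of "t u $ i"] by (simp add: abs_minus_commute)
  have Qr_le: "\<bar>Q * r u i\<bar> \<le> Q / 2" for u i
    using mult_left_mono[OF r_le[of u i], of Q] by (simp add: abs_mult)
  have cell_close: "\<bar>of_int (cell u $ i) - Q * r u i\<bar> \<le> 1 / 2" for u i
    using of_int_round_abs_le[of "Q * r u i"] by (simp only: cell_def vec_lambda_beta)
  have inj: "inj_on cell S"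
  proof (rule inj_onI, rule ccontr)
    fix u v assume uv: "u \<in> S" "v \<in> S" "cell u = cell v" "u \<noteq> v"
    have "\<bar>r u i - r v i\<bar> < 1 / Q" for i
    proof -
      have "round (Q * r u i) = round (Q * r v i)"
        using uv(3) by (simp add: cell_def vec_eq_iff)
      then have "\<bar>Q * r u i - Q * r v i\<bar> < 1"
        unfolding round_def by linarith
      then have "Q * \<bar>r u i - r v i\<bar> < 1"
        by (simp add: abs_mult flip: right_diff_distrib)
      then show ?thesis using Q by (simp add: field_simps)
    qed
    then have "infnorm (t u - t v - of_int_vec (\<chi> i. round (t u $ i) - round (t v $ i))) < 1 / Q"
      by (simp add: infnorm_less_iff r_def algebra_simps)
    then have "int_dist (t u - t v) < 1 / Q"
      using int_dist_le order.strict_trans1 by blast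
    with sep[OF uv(1,2,4)] show False by simp
  qed
  have cellB: "cell u $ i \<in> B" for u i
  proof -
    have "real_of_int \<bar>cell u $ i\<bar> \<le> Q / 2 + 1 / 2"
      using cell_close[of u i] Qr_le[of u i] unfolding of_int_abs by linarith
    also have "\<dots> \<le> real_of_int (int Q)" using Q by simp
    finally have "\<bar>cell u $ i\<bar> \<le> int Q" by (simp only: of_int_le_iff)
    then show ?thesis by (auto simp: B_def)
  qed
  have factor: "(norm (exp_sum (2 * Q) (t u $ i)))\<^sup>2 \<le> g (cell u $ i)" for u i
  proof (cases "cell u $ i = 0")
    case True
    have "(norm (exp_sum (2 * Q) (t u $ i)))\<^sup>2 \<le> (real (2 * Q))\<^sup>2"
      by (intro power_mono norm_exp_sum_le) simp
    then show ?thesis using True by (simp add: g_def power_mult_distrib)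
  next
    case False
    define k where "k = real_of_int \<bar>cell u $ i\<bar>"
    have k: "k \<ge> 1" using False unfolding k_def by linarith
    \<comment> \<open>Rounding to a nonzero integer at most doubles the absolute value.\<close>
    have kr: "k \<le> 2 * Q * \<bar>r u i\<bar>"
    proof -
      have "k \<le> \<bar>Q * r u i\<bar> + 1 / 2" unfolding k_def of_int_abs using cell_close[of u i] by linarith
      then show ?thesis using k by (simp add: abs_mult)
    qed
    have r0: "r u i \<noteq> 0" using kr k by auto
    have "norm (exp_sum (2 * Q) (t u $ i)) = norm (exp_sum (2 * Q) (r u i))"
      by (simp add: r_def exp_sum_shift)
    also have "\<dots> \<le> 1 / (2 * \<bar>r u i\<bar>)"
      by (rule norm_exp_sum_upper) (use r_le r0 in auto)
    also have "\<dots> \<le> Q / k"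
      using kr k r0 by (simp add: field_simps)
    finally have "(norm (exp_sum (2 * Q) (t u $ i)))\<^sup>2 \<le> (Q / k)\<^sup>2"
      by (intro power_mono) auto
    then show ?thesis using False by (simp add: g_def k_def power_divide)
  qed
  have g_nonneg: "g k \<ge> 0" for k by (simp add: g_def)
  have sum_g: "(\<Sum>k\<in>B. g k) \<le> 8 * (real Q)\<^sup>2"
  proof -
    have B_eq: "B = {0} \<union> ({1..int Q} \<union> uminus ` {1..int Q})" by (auto simp: B_def)
    have pos: "(\<Sum>k\<in>{1..int Q}. g k) = (real Q)\<^sup>2 * (\<Sum>k=1..Q. 1 / real k ^ 2)"
      unfolding sum_distrib_left
      by (rule sum.reindex_bij_witness[where i = int and j = nat]) (auto simp: g_def)
    have neg: "(\<Sum>k\<in>uminus ` {1..int Q}. g k) = (\<Sum>k\<in>{1..int Q}. g k)"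
      by (subst sum.reindex) (auto simp: g_def inj_on_def)
    have "sum g B = sum g {0} + sum g ({1..int Q} \<union> uminus ` {1..int Q})"
      unfolding B_eq by (rule sum.union_disjoint) auto
    also have "sum g ({1..int Q} \<union> uminus ` {1..int Q}) = sum g {1..int Q} + sum g (uminus ` {1..int Q})"
      by (rule sum.union_disjoint) auto
    also have "sum g {0} + \<dots> = g 0 + 2 * sum g {1..int Q}"
      unfolding neg by simp
    also have "\<dots> = 4 * (real Q)\<^sup>2 + 2 * ((real Q)\<^sup>2 * (\<Sum>k=1..Q. 1 / real k ^ 2))"
      unfolding pos by (simp add: g_def)
    also have "\<dots> \<le> 4 * (real Q)\<^sup>2 + 2 * ((real Q)\<^sup>2 * 2)"
      by (intro add_left_mono mult_left_mono sum_inverse_squares_le) auto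
    finally show ?thesis by simp
  qed
  have "(\<Sum>u\<in>S. (norm (box_sum (2 * Q) (t u)))\<^sup>2) \<le> (\<Sum>u\<in>S. \<Prod>i\<in>UNIV. g (cell u $ i))"
    by (intro sum_mono)
       (auto simp: box_sum_eq_prod prod_power_distrib intro!: prod_mono factor simp flip: prod_norm)
  also have "\<dots> = (\<Sum>k\<in>cell ` S. \<Prod>i\<in>UNIV. g (k $ i))"
    by (simp add: sum.reindex[OF inj])
  also have "\<dots> \<le> (\<Sum>k\<in>{k :: int ^ 'n. \<forall>i. k $ i \<in> B}. \<Prod>i\<in>UNIV. g (k $ i))"
  proof (rule sum_mono2)
    show "finite {k :: int ^ 'n. \<forall>i. k $ i \<in> B}"
      by (rule finite_vec) (simp add: B_def)
    show "cell ` S \<subseteq> {k. \<forall>i. k $ i \<in> B}"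
      using cellB by auto
  qed (simp add: g_nonneg prod_nonneg)
  also have "\<dots> = (\<Prod>i\<in>(UNIV :: 'n set). \<Sum>k\<in>B. g k)"
    by (rule sum_prod_vec) (simp add: B_def)
  also have "\<dots> \<le> (8 * (real Q)\<^sup>2) ^ CARD('n)"
    unfolding prod_constant by (intro power_mono sum_g sum_nonneg g_nonneg)
  finally show ?thesis .
qed

lemma box_sum_norm_square:
  "complex_of_real ((norm (box_sum R t))\<^sup>2)
     = (\<Sum>u\<in>cube R. \<Sum>v\<in>cube R. cis (2 * pi * (t \<bullet> of_int_vec (u - v))))"
proof -
  have "complex_of_real ((norm (box_sum R t))\<^sup>2) = box_sum R t * cnj (box_sum R t)"
    by (rule complex_norm_square)
  also have "\<dots> = (\<Sum>u\<in>cube R. \<Sum>v\<in>cube R. cis (2 * pi * (t \<bullet> of_int_vec (u - v))))"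
    unfolding box_sum_def cnj_sum sum_product
    by (simp add: cis_cnj cis_mult of_int_vec_diff inner_diff_right algebra_simps)
  finally show ?thesis .
qed

text \<open>
  Expanding the left-hand square gives the characters \<open>e(((y - z) A - \<eta>) \<bullet> (u - v))\<close>. Moving \<open>A\<close> to the
  other side of the inner product and summing over \<open>y, z\<close> first, they become, up to the unimodular
  factor that carries \<open>\<eta>\<close>, the square on the right.
\<close>

lemma box_sum_duality:
  fixes A :: "real ^ 'm ^ 'n"
  shows "(\<Sum>y\<in>cube R. \<Sum>z\<in>cube R. (norm (box_sum H (of_int_vec (y - z) v* A - \<eta>)))\<^sup>2)
    \<le> (\<Sum>u\<in>cube H. \<Sum>v\<in>cube H. (norm (box_sum R (A *v of_int_vec (u - v))))\<^sup>2)"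
proof -
  have swap: "(\<Sum>y\<in>Y. \<Sum>z\<in>Y. \<Sum>u\<in>U. \<Sum>v\<in>U. F y z u v)
      = (\<Sum>u\<in>U. \<Sum>v\<in>U. \<Sum>y\<in>Y. \<Sum>z\<in>Y. F y z u v)"
    for F :: "'a \<Rightarrow> 'a \<Rightarrow> 'b \<Rightarrow> 'b \<Rightarrow> complex" and Y U
  proof -
    have "(\<Sum>p\<in>Y \<times> Y. \<Sum>q\<in>U \<times> U. F (fst p) (snd p) (fst q) (snd q))
        = (\<Sum>q\<in>U \<times> U. \<Sum>p\<in>Y \<times> Y. F (fst p) (snd p) (fst q) (snd q))"
      by (rule sum.swap)
    then show ?thesis by (simp only: sum.cartesian_product' fst_conv snd_conv)
  qed
  let ?T = "\<lambda>y z u v. cis (2 * pi * ((of_int_vec (y - z) v* A - \<eta>) \<bullet> of_int_vec (u - v)))"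
  have T: "?T y z u v = cis (- (2 * pi * (\<eta> \<bullet> of_int_vec (u - v))))
      * cis (2 * pi * ((A *v of_int_vec (u - v)) \<bullet> of_int_vec (y - z)))"
    for y z :: "int ^ 'n" and u v :: "int ^ 'm"
    by (simp add: cis_mult inner_diff_left dot_lmul_matrix inner_commute[of "A *v _"] right_diff_distrib)
  have "complex_of_real (\<Sum>y\<in>cube R. \<Sum>z\<in>cube R. (norm (box_sum H (of_int_vec (y - z) v* A - \<eta>)))\<^sup>2)
      = (\<Sum>y\<in>cube R. \<Sum>z\<in>cube R. \<Sum>u\<in>cube H. \<Sum>v\<in>cube H. ?T y z u v)"
    by (simp only: of_real_sum box_sum_norm_square)
  also have "\<dots> = (\<Sum>u\<in>cube H. \<Sum>v\<in>cube H. \<Sum>y\<in>cube R. \<Sum>z\<in>cube R. ?T y z u v)"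
    by (rule swap)
  also have "\<dots> = (\<Sum>u\<in>cube H. \<Sum>v\<in>cube H. cis (- (2 * pi * (\<eta> \<bullet> of_int_vec (u - v))))
      * complex_of_real ((norm (box_sum R (A *v of_int_vec (u - v))))\<^sup>2))"
    by (simp only: T box_sum_norm_square sum_distrib_left)
  finally have expansion: "complex_of_real (\<Sum>y\<in>cube R. \<Sum>z\<in>cube R. (norm (box_sum H (of_int_vec (y - z) v* A - \<eta>)))\<^sup>2)
      = (\<Sum>u\<in>cube H. \<Sum>v\<in>cube H. cis (- (2 * pi * (\<eta> \<bullet> of_int_vec (u - v))))
      * complex_of_real ((norm (box_sum R (A *v of_int_vec (u - v))))\<^sup>2))" .
  have "(\<Sum>y\<in>cube R. \<Sum>z\<in>cube R. (norm (box_sum H (of_int_vec (y - z) v* A - \<eta>)))\<^sup>2)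
      \<le> norm (complex_of_real (\<Sum>y\<in>cube R. \<Sum>z\<in>cube R. (norm (box_sum H (of_int_vec (y - z) v* A - \<eta>)))\<^sup>2))"
    unfolding norm_of_real by (rule abs_ge_self)
  also have "\<dots> \<le> (\<Sum>u\<in>cube H. \<Sum>v\<in>cube H. (norm (box_sum R (A *v of_int_vec (u - v))))\<^sup>2)"
    unfolding expansion by (intro order.trans[OF norm_sum] sum_mono) (simp add: norm_mult norm_power)
  finally show ?thesis .
qed

text \<open>
  Each \<open>x\<close> with \<open>|x| < Q\<close> is the difference of \<open>s + x\<^sup>+\<close> and \<open>s + x\<^sup>-\<close>, with the positive and negative
  parts taken coordinatewise, for every \<open>s\<close> in the cube of side \<open>Q\<close>; these pairs are distinct. Weighting
  \<open>x\<close> by its number of representations plays the part of a Fejer kernel.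
\<close>

lemma sum_le_sum_differences:
  fixes f :: "int ^ 'n \<Rightarrow> real"
  assumes f: "\<And>x. f x \<ge> 0" and X: "\<And>x. x \<in> X \<Longrightarrow> infnorm (of_int_vec x) < real Q"
  shows "real Q ^ CARD('n) * sum f X \<le> (\<Sum>y\<in>cube (2 * Q). \<Sum>z\<in>cube (2 * Q). f (y - z))"
proof -
  have Xi: "\<bar>x $ i\<bar> < int Q" if "x \<in> X" for x i
  proof -
    have "real_of_int \<bar>x $ i\<bar> < real_of_int (int Q)"
      using X[OF that] by (simp add: infnorm_less_iff)
    then show ?thesis by (simp only: of_int_less_iff)
  qed
  define h where "h = (\<lambda>(x :: int ^ 'n, s). (\<chi> i. s $ i + max 0 (x $ i), \<chi> i. s $ i + max 0 (- x $ i)) :: (int ^ 'n) \<times> (int ^ 'n))"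
  have h_diff: "fst (h (x, s)) - snd (h (x, s)) = x" for x s
    by (auto simp: h_def vec_eq_iff)
  have inj: "inj_on h (X \<times> cube Q)"
  proof (rule inj_onI)
    fix p p' assume eq: "h p = h p'"
    obtain x s x' s' where p: "p = (x, s)" "p' = (x', s')" by fastforce
    have x: "x = x'" using h_diff[of x s] h_diff[of x' s'] eq p by simp
    have "s = s'" using eq by (simp add: p x h_def vec_eq_iff)
    with x p show "p = p'" by simp
  qed
  have sub: "h ` (X \<times> cube Q) \<subseteq> cube (2 * Q) \<times> cube (2 * Q)"
  proof (rule image_subsetI, clarify)
    fix x s :: "int ^ 'n" assume xs: "x \<in> X" "s \<in> cube Q"
    have "s $ i + max 0 (x $ i) \<in> {0..<int (2 * Q)}" "s $ i + max 0 (- x $ i) \<in> {0..<int (2 * Q)}" for i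
    proof -
      have "s $ i \<in> {0..<int Q}" using xs(2) by (auto simp: cube_def)
      then show "s $ i + max 0 (x $ i) \<in> {0..<int (2 * Q)}" "s $ i + max 0 (- x $ i) \<in> {0..<int (2 * Q)}"
        using Xi[OF xs(1), of i] by auto
    qed
    then show "h (x, s) \<in> cube (2 * Q) \<times> cube (2 * Q)"
      by (simp add: h_def cube_def)
  qed
  have "real Q ^ CARD('n) * sum f X = (\<Sum>(x, s)\<in>X \<times> (cube Q :: (int ^ 'n) set). f x)"
    by (simp flip: sum.cartesian_product add: sum_distrib_left)
  also have "\<dots> = (\<Sum>p\<in>X \<times> cube Q. f (fst (h p) - snd (h p)))"
    by (intro sum.cong) (auto simp: h_diff)
  also have "\<dots> = (\<Sum>(y, z)\<in>h ` (X \<times> cube Q). f (y - z))"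
    by (subst sum.reindex[OF inj]) (simp add: case_prod_beta)
  also have "\<dots> \<le> (\<Sum>(y, z)\<in>cube (2 * Q) \<times> cube (2 * Q). f (y - z))"
    by (rule sum_mono2[OF _ sub]) (auto simp: f)
  finally show ?thesis by (simp only: sum.cartesian_product)
qed

text \<open>The transference principle: if \<open>A\<close> takes no short integer vector \<open>q\<close> too close to an integer
  point, then the points \<open>x A\<close> do not cluster on the torus.\<close>

lemma card_near_le:
  fixes A :: "real ^ 'm ^ 'n"
  assumes Q: "Q > 0" and H: "H > 0" "2 * real H * \<delta> \<le> 1"
    and sep: "\<And>q :: int ^ 'm. q \<noteq> 0 \<Longrightarrow> infnorm (of_int_vec q) < H \<Longrightarrow> 1 / real Q \<le> int_dist (A *v of_int_vec q)"
  shows "real (card {x :: int ^ 'n. int_dist (of_int_vec x v* A - \<eta>) < \<delta> \<and> infnorm (of_int_vec x) < real Q})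
    \<le> (8 * real Q) ^ CARD('n) * (pi\<^sup>2 / (4 * real H)) ^ CARD('m)"
proof -
  define X where "X = {x :: int ^ 'n. int_dist (of_int_vec x v* A - \<eta>) < \<delta> \<and> infnorm (of_int_vec x) < real Q}"
  let ?f = "\<lambda>x. (norm (box_sum H (of_int_vec x v* A - \<eta>)))\<^sup>2"
  let ?n = "CARD('n)" and ?m = "CARD('m)"
  have "(\<Sum>v\<in>cube H. (norm (box_sum (2 * Q) (A *v of_int_vec (u - v))))\<^sup>2) \<le> (8 * (real Q)\<^sup>2) ^ ?n"
    if u: "u \<in> cube H" for u
  proof (rule separated_box_sum_le[OF finite_cube Q])
    fix v w :: "int ^ 'm" assume vw: "v \<in> cube H" "w \<in> cube H" "v \<noteq> w"
    have "\<bar>w $ i - v $ i\<bar> < int H" for i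
    proof -
      have "v $ i \<in> {0..<int H}" "w $ i \<in> {0..<int H}" using vw(1,2) by (auto simp: cube_def)
      then show ?thesis by auto
    qed
    then have "\<bar>real_of_int ((w - v) $ i)\<bar> < real H" for i
      by (metis of_int_abs of_int_less_iff of_int_of_nat_eq vector_minus_component)
    then have "infnorm (of_int_vec (w - v)) < H"
      by (simp add: infnorm_less_iff)
    then have "1 / Q \<le> int_dist (A *v of_int_vec (w - v))"
      by (intro sep) (use vw in auto)
    also have "A *v of_int_vec (w - v) = A *v of_int_vec (u - v) - A *v of_int_vec (u - w)"
      by (simp add: of_int_vec_diff matrix_vector_mult_diff_distrib)
    finally show "1 / real Q \<le> int_dist (A *v of_int_vec (u - v) - A *v of_int_vec (u - w))" .
  qed
  then have "(\<Sum>u\<in>cube H. \<Sum>v\<in>cube H. (norm (box_sum (2 * Q) (A *v of_int_vec (u - v))))\<^sup>2)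
      \<le> (\<Sum>u\<in>(cube H :: (int ^ 'm) set). (8 * (real Q)\<^sup>2) ^ ?n)"
    by (intro sum_mono) auto
  with box_sum_duality[where R = "2 * Q" and H = H and A = A and \<eta> = \<eta>]
  have upper: "(\<Sum>y\<in>cube (2 * Q). \<Sum>z\<in>cube (2 * Q). ?f (y - z)) \<le> real H ^ ?m * (8 * (real Q)\<^sup>2) ^ ?n"
    by simp
  have "?f x \<ge> ((2 * real H / pi) ^ ?m)\<^sup>2" if "x \<in> X" for x
    using that H(2) by (intro power_mono norm_box_sum_lower[of _ \<delta>]) (auto simp: X_def)
  then have "card X * ((2 * real H / pi) ^ ?m)\<^sup>2 \<le> sum ?f X"
    by (intro sum_bounded_below)
  then have "real Q ^ ?n * (card X * ((2 * real H / pi) ^ ?m)\<^sup>2) \<le> real Q ^ ?n * sum ?f X"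
    by (rule mult_left_mono) simp
  also have "\<dots> \<le> (\<Sum>y\<in>cube (2 * Q). \<Sum>z\<in>cube (2 * Q). ?f (y - z))"
    by (rule sum_le_sum_differences) (auto simp: X_def)
  also note upper
  finally have *: "real Q ^ ?n * (card X * ((2 * real H / pi) ^ ?m)\<^sup>2) \<le> real H ^ ?m * (8 * (real Q)\<^sup>2) ^ ?n" .
  have "real (card X) = real Q ^ ?n * (card X * ((2 * real H / pi) ^ ?m)\<^sup>2) / (real Q ^ ?n * ((2 * real H / pi) ^ ?m)\<^sup>2)"
    using Q H by simp
  also have "\<dots> \<le> real H ^ ?m * (8 * (real Q)\<^sup>2) ^ ?n / (real Q ^ ?n * ((2 * real H / pi) ^ ?m)\<^sup>2)"
    by (rule divide_right_mono[OF *]) simp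
  also have "\<dots> = (8 * (real Q)\<^sup>2 / real Q) ^ ?n * (real H / (2 * real H / pi)\<^sup>2) ^ ?m"
  proof -
    have "((2 * real H / pi) ^ ?m)\<^sup>2 = ((2 * real H / pi)\<^sup>2) ^ ?m"
      by (metis power_mult mult.commute)
    moreover have "a ^ ?m * b ^ ?n / (c ^ ?n * d ^ ?m) = (b / c) ^ ?n * (a / d) ^ ?m" for a b c d :: real
      by (simp add: power_divide)
    ultimately show ?thesis by (simp only:)
  qed
  also have "\<dots> = (8 * real Q) ^ ?n * (pi\<^sup>2 / (4 * real H)) ^ ?m"
  proof -
    have "8 * (real Q)\<^sup>2 / real Q = 8 * real Q" using Q by (simp add: power2_eq_square)
    moreover have "real H / (2 * real H / pi)\<^sup>2 = pi\<^sup>2 / (4 * real H)"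
      using H by (simp add: power2_eq_square field_simps)
    ultimately show ?thesis by (simp only:)
  qed
  finally show ?thesis by (simp add: X_def)
qed

section \<open>Counting points under a diophantine exponent\<close>

abbreviation near_points :: "real ^ 'm ^ 'n \<Rightarrow> nat \<Rightarrow> real \<Rightarrow> real ^ 'm \<Rightarrow> (int ^ 'n) set"
  where "near_points A Q \<delta> \<eta> \<equiv>
    {x. int_dist (of_int_vec x v* A - \<eta>) < \<delta> \<and> infnorm (of_int_vec x) < real Q}"

lemma
  fixes Q :: nat
  shows finite_infnorm_less: "finite {x :: int ^ 'n. infnorm (of_int_vec x) < real Q}"
    and card_infnorm_less: "card {x :: int ^ 'n. infnorm (of_int_vec x) < real Q} \<le> (2 * Q) ^ CARD('n)"
proof -
  have eq: "{x :: int ^ 'n. infnorm (of_int_vec x) < real Q} = {x. \<forall>i. x $ i \<in> {- int Q<..<int Q}}"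
  proof -
    have "\<bar>real_of_int k\<bar> < real Q \<longleftrightarrow> k \<in> {- int Q<..<int Q}" for k
      by auto
    then show ?thesis by (simp add: infnorm_less_iff)
  qed
  show "finite {x :: int ^ 'n. infnorm (of_int_vec x) < real Q}"
    unfolding eq by (rule finite_vec) simp
  show "card {x :: int ^ 'n. infnorm (of_int_vec x) < real Q} \<le> (2 * Q) ^ CARD('n)"
    unfolding eq card_vec[OF finite_greaterThanLessThan_int] by (rule power_mono) auto
qed

lemma finite_near_points [simp]: "finite (near_points A Q \<delta> \<eta>)"
  by (rule finite_subset[OF _ finite_infnorm_less]) auto

lemma card_near_points_le:
  fixes A :: "real ^ 'm ^ 'n"
  shows "real (card (near_points A Q \<delta> \<eta>)) \<le> (2 * real Q) ^ CARD('n)"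
proof -
  have "card (near_points A Q \<delta> \<eta>) \<le> card {x :: int ^ 'n. infnorm (of_int_vec x) < real Q}"
    by (rule card_mono[OF finite_infnorm_less]) auto
  also note card_infnorm_less
  finally show ?thesis by (simp flip: of_nat_le_iff[where 'a = real])
qed

text \<open>
  If \<open>A q\<close> is integral, then so are all the vectors \<open>A (k q)\<close>, which makes every real number
  admissible in the definition of the exponent. The hypothesis is a vanishing infimum, so the
  argument approximates: a point within \<open>c / k\<close> of \<open>A q\<close> yields one within \<open>c\<close> of \<open>A (k q)\<close>.
\<close>

lemma dioph_exponent_infinite_if_integral:
  fixes A :: "real ^ 'm ^ 'n"
  assumes "q \<noteq> 0" "int_dist (A *v of_int_vec q) \<le> 0"
  shows "infinite {q. int_dist (A *v of_int_vec q) < infnorm (of_int_vec q) powr (- w)}"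
proof -
  obtain i where i: "q $ i \<noteq> 0" using assms(1) by (auto simp: vec_eq_iff)
  have "int_dist (A *v of_int_vec (k *s q)) < c" if "k > 0" "c > 0" for k :: int and c
  proof -
    have "int_dist (A *v of_int_vec q) < c / of_int k"
      using that by (intro order.strict_trans1[OF assms(2)]) simp
    then obtain z where z: "\<And>j. \<bar>(A *v of_int_vec q) $ j - of_int (z $ j)\<bar> < c / of_int k"
      by (auto simp: int_dist_less_iff infnorm_less_iff)
    have scale: "of_int_vec (k *s q) = of_int k *s of_int_vec q" by (simp add: vec_eq_iff)
    have "\<bar>(A *v of_int_vec (k *s q) - of_int_vec (k *s z)) $ j\<bar> < c" for j
    proof -
      have "(A *v of_int_vec (k *s q) - of_int_vec (k *s z)) $ j
          = of_int k * ((A *v of_int_vec q) $ j - of_int (z $ j))"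
        by (simp add: scale matrix_vector_mult_scaleR scalar_mult_eq_scaleR right_diff_distrib)
      moreover have "of_int k * \<bar>(A *v of_int_vec q) $ j - of_int (z $ j)\<bar> < c"
        using z[of j] that by (simp add: field_simps)
      ultimately show ?thesis using that by (simp only: abs_mult abs_of_pos of_int_0_less_iff)
    qed
    then show ?thesis unfolding int_dist_less_iff infnorm_less_iff by blast
  qed
  moreover have "infnorm (of_int_vec (k *s q)) powr (- w) > 0" if "k > 0" for k
  proof -
    have "infnorm (of_int_vec (k *s q)) > 0"
      using i that by (auto simp: infnorm_pos_lt vec_eq_iff)
    then show ?thesis by simp
  qed
  ultimately have "(\<lambda>k. k *s q) ` {0<..}
      \<subseteq> {q. int_dist (A *v of_int_vec q) < infnorm (of_int_vec q) powr (- w)}"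
    by auto
  moreover have "infinite ((\<lambda>k. k *s q) ` {0 :: int<..})"
    using i by (subst finite_image_iff) (auto simp: inj_on_def vec_eq_iff infinite_Ioi)
  ultimately show ?thesis using infinite_super by blast
qed

text \<open>Only finitely many \<open>q\<close> violate the bound by a power of \<open>|q|\<close>. For these the distance is positive,
  since a vanishing one would make the exponent infinite, and \<open>c\<close> is the least of
  these distances and \<open>1\<close>.\<close>

lemma int_dist_lower_bound:
  fixes A :: "real ^ 'm ^ 'n"
  assumes "dioph_exponent A < ereal w"
  shows "\<exists>c>0. \<forall>q. q \<noteq> 0 \<longrightarrow>
    min c (infnorm (of_int_vec q) powr (- w)) \<le> int_dist (A *v of_int_vec q)"
proof -
  define F where "F = {q. int_dist (A *v of_int_vec q) < infnorm (of_int_vec q) powr (- w)}"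
  have F: "finite F"
  proof (rule ccontr)
    assume "infinite F"
    then have "ereal w \<le> dioph_exponent A"
      unfolding dioph_exponent_def F_def by (intro Sup_upper) blast
    with assms show False by simp
  qed
  have pos: "int_dist (A *v of_int_vec q) > 0" if "q \<noteq> 0" for q
    using dioph_exponent_infinite_if_integral[OF that, of A w] F by (force simp: F_def)
  define c where "c = Min (insert 1 ((\<lambda>q. int_dist (A *v of_int_vec q)) ` (F - {0})))"
  have "c > 0" unfolding c_def using F pos by (subst Min_gr_iff) auto
  moreover have "c \<le> int_dist (A *v of_int_vec q)" if "q \<in> F" "q \<noteq> 0" for q
    unfolding c_def using F that by (intro Min_le) auto
  ultimately show ?thesis
    by (intro exI[of _ c]) (auto simp: F_def min_le_iff_disj not_less)
qed

lemma infnorm_of_int_vec_ge_1: "q \<noteq> 0 \<Longrightarrow> infnorm (of_int_vec (q :: int ^ 'n)) \<ge> 1"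
proof -
  assume "q \<noteq> 0"
  then obtain i where "q $ i \<noteq> 0" by (auto simp: vec_eq_iff)
  then have "1 \<le> \<bar>of_int_vec q $ i\<bar>" by simp
  also have "\<dots> \<le> infnorm (of_int_vec q)" by (rule component_le_infnorm_cart)
  finally show ?thesis .
qed

lemma C_const_eq: "(8 * x) ^ n * (pi\<^sup>2 * \<delta>) ^ m = C_const n m * \<delta> ^ m * x ^ n"
  by (simp add: C_const_def power_mult_distrib flip: power_mult)

text \<open>
  If \<open>\<delta> > 1 / 2\<close> the bound holds by the trivial estimate \<open>(2 Q)^n\<close>. This settles every exponent for
  which \<open>real_of_ereal (1 / \<omega>) \<le> 0\<close>, that is \<open>\<omega> = \<infinity>\<close> or \<open>\<omega> \<le> 0\<close> (the value of \<open>1 / 0 = \<infinity>\<close> is read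
  as \<open>0\<close>), because then \<open>\<delta> \<ge> Q^\<epsilon> \<ge> 1\<close>. In the remaining case
  \<open>0 < \<omega> < \<infinity>\<close>, and the transference principle applies with the integer part of \<open>1 / (2 \<delta>)\<close> for \<open>H\<close>.
\<close>

lemma near_points_bound:
  fixes A :: "real ^ 'm ^ 'n"
  assumes \<epsilon>: "\<epsilon> > 0"
  shows "\<exists>Q0>0. \<forall>\<eta> Q \<delta>. real Q \<ge> Q0 \<longrightarrow>
    \<delta> \<ge> real Q powr (- real_of_ereal (1 / dioph_exponent A) + \<epsilon>) \<longrightarrow>
    real (card (near_points A Q \<delta> \<eta>)) \<le> C_const CARD('n) CARD('m) * \<delta> ^ CARD('m) * real Q ^ CARD('n)"
proof -
  define s where "s = real_of_ereal (1 / dioph_exponent A)"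
  define goal where "goal = (\<lambda>\<eta> Q \<delta>. real (card (near_points A Q \<delta> \<eta>))
    \<le> C_const CARD('n) CARD('m) * \<delta> ^ CARD('m) * real Q ^ CARD('n))"
  have large: "goal \<eta> Q \<delta>" if "\<delta> > 1 / 2" for \<eta> Q \<delta>
  proof -
    have "1 \<le> pi\<^sup>2 * \<delta>"
      using mult_mono[of 4 "pi\<^sup>2" "1/2" \<delta>] power_mono[OF pi_ge_two, of 2] that by simp
    then have "1 \<le> (pi\<^sup>2 * \<delta>) ^ CARD('m)" by (rule one_le_power)
    moreover have "(2 * real Q) ^ CARD('n) \<le> (8 * real Q) ^ CARD('n)" by (intro power_mono) auto
    ultimately have "(2 * real Q) ^ CARD('n) * 1 \<le> (8 * real Q) ^ CARD('n) * (pi\<^sup>2 * \<delta>) ^ CARD('m)"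
      by (intro mult_mono) auto
    then have "(2 * real Q) ^ CARD('n) \<le> C_const CARD('n) CARD('m) * \<delta> ^ CARD('m) * real Q ^ CARD('n)"
      by (simp only: C_const_eq mult_1_right)
    with card_near_points_le show ?thesis unfolding goal_def by (rule order.trans)
  qed
  show ?thesis
  proof (cases "s > 0")
    case False
    have "goal \<eta> Q \<delta>" if "real Q \<ge> 1" "\<delta> \<ge> real Q powr (- s + \<epsilon>)" for \<eta> Q \<delta>
    proof -
      have "1 \<le> real Q powr (- s + \<epsilon>)"
        using that False \<epsilon> by (intro ge_one_powr_ge_zero) auto
      with that show ?thesis by (intro large) auto
    qed
    then show ?thesis unfolding s_def goal_def by (intro exI[of _ 1]) auto
  next
    case True
    then obtain w where w: "dioph_exponent A = ereal w" "w > 0" "s = 1 / w"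
      unfolding s_def by (cases "dioph_exponent A") (auto simp: one_ereal_def split: if_splits)
    \<comment> \<open>This \<open>w'\<close> exceeds the exponent \<open>w\<close> and satisfies \<open>(1 / w - \<epsilon>) w' = 1 - (\<epsilon> w)\<^sup>2 \<le> 1\<close>,
      which turns the bound \<open>|q| \<le> Q^(1 / w - \<epsilon>)\<close> into \<open>|q|^(-w') \<ge> 1 / Q\<close>.\<close>
    define w' where "w' = w + \<epsilon> * w\<^sup>2"
    have w': "w' > w" "w' > 0" using \<epsilon> w(2) by (auto simp: w'_def add_pos_pos)
    have sw': "(s - \<epsilon>) * w' \<le> 1"
    proof -
      have "(s - \<epsilon>) * w' = 1 - (\<epsilon> * w)\<^sup>2"
        using w(2) by (simp add: w(3) w'_def power2_eq_square field_simps)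
      then show ?thesis by simp
    qed
    obtain c where c: "c > 0"
      "\<And>q. q \<noteq> 0 \<Longrightarrow> min c (infnorm (of_int_vec q) powr (- w')) \<le> int_dist (A *v of_int_vec q)"
      using int_dist_lower_bound[of A w'] w w'(1) by auto
    have "goal \<eta> Q \<delta>" if Q: "real Q \<ge> max 1 (1 / c)" and \<delta>: "\<delta> \<ge> real Q powr (- s + \<epsilon>)" for \<eta> Q \<delta>
    proof (cases "\<delta> > 1 / 2")
      case False
      have "\<delta> > 0" using \<delta> Q by (auto intro: less_le_trans[OF _ \<delta>])
      define H where "H = nat \<lfloor>1 / (2 * \<delta>)\<rfloor>"
      have ge1: "1 \<le> 1 / (2 * \<delta>)" using False \<open>\<delta> > 0\<close> by (simp add: field_simps)
      then have floor1: "1 \<le> \<lfloor>1 / (2 * \<delta>)\<rfloor>" by simp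
      have Hfloor: "real H = of_int \<lfloor>1 / (2 * \<delta>)\<rfloor>" unfolding H_def using floor1 by (intro of_nat_nat) linarith
      have H1: "1 \<le> real H" using floor1 by (simp add: Hfloor)
      have Hle: "H \<le> 1 / (2 * \<delta>)" by (simp add: Hfloor)
      \<comment> \<open>An integer part that is at least \<open>1\<close> is at least half of the number.\<close>
      have Hge: "1 / (4 * \<delta>) \<le> H"
      proof -
        have "1 / (2 * \<delta>) < real H + 1" unfolding Hfloor by linarith
        then show ?thesis using H1 by simp
      qed
      have Q1: "real Q \<ge> 1" using Q by simp
      have "real (card (near_points A Q \<delta> \<eta>)) \<le> (8 * real Q) ^ CARD('n) * (pi\<^sup>2 / (4 * real H)) ^ CARD('m)"
      proof (rule card_near_le)
        show "Q > 0" "H > 0" using Q1 H1 by auto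
        show "2 * real H * \<delta> \<le> 1" using Hle \<open>\<delta> > 0\<close> by (simp add: field_simps)
        fix q :: "int ^ 'm" assume q: "q \<noteq> 0" "infnorm (of_int_vec q) < H"
        let ?q = "infnorm (of_int_vec q)"
        have "1 / (2 * \<delta>) \<le> 1 / \<delta>" using \<open>\<delta> > 0\<close> by (simp add: field_simps)
        then have "?q \<le> 1 / \<delta>" using q(2) Hle by linarith
        also have "\<dots> \<le> 1 / real Q powr (- s + \<epsilon>)"
          using \<delta> \<open>\<delta> > 0\<close> Q1 by (intro divide_left_mono) auto
        also have "\<dots> = real Q powr (s - \<epsilon>)"
          by (simp add: powr_minus_divide[symmetric])
        finally have "(real Q powr (s - \<epsilon>)) powr (- w') \<le> ?q powr (- w')"
          using infnorm_of_int_vec_ge_1[OF q(1)] w'(2) by (intro powr_mono2') auto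
        moreover have "1 / real Q \<le> (real Q powr (s - \<epsilon>)) powr (- w')"
        proof -
          have "1 / real Q = real Q powr (- 1)" using Q1 by (simp add: powr_minus_divide)
          also have "\<dots> \<le> real Q powr ((s - \<epsilon>) * (- w'))"
            using sw' Q1 by (intro powr_mono) auto
          finally show ?thesis by (simp add: powr_powr)
        qed
        moreover have "1 / real Q \<le> c"
          using Q Q1 c(1) by (simp add: field_simps)
        ultimately show "1 / real Q \<le> int_dist (A *v of_int_vec q)"
          using c(2)[OF q(1)] by simp
      qed
      also have "\<dots> \<le> (8 * real Q) ^ CARD('n) * (pi\<^sup>2 * \<delta>) ^ CARD('m)"
      proof -
        have "1 / (4 * real H) \<le> \<delta>" using Hge H1 \<open>\<delta> > 0\<close> by (simp add: field_simps)
        then have "pi\<^sup>2 * (1 / (4 * real H)) \<le> pi\<^sup>2 * \<delta>" by (rule mult_left_mono) simp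
        then show ?thesis by (intro mult_left_mono power_mono) auto
      qed
      also have "\<dots> = C_const CARD('n) CARD('m) * \<delta> ^ CARD('m) * real Q ^ CARD('n)"
        by (rule C_const_eq)
      finally show ?thesis by (simp add: goal_def)
    qed (rule large)
    then show ?thesis unfolding s_def goal_def by (intro exI[of _ "max 1 (1 / c)"]) auto
  qed
qed

text \<open>
  For \<open>Q \<ge> Q0\<close> and \<open>\<delta>\<close> below the threshold \<open>\<delta>0 = Q^(-1/\<omega> + \<epsilon>/m)\<close>, enlarge \<open>\<delta>\<close> to \<open>\<delta>0\<close>; then \<open>\<delta>0^m Q^n\<close> is exactly
  the required power of \<open>Q\<close>. The finitely many \<open>Q < Q0\<close> are absorbed by the constant, whose factor
  \<open>max 1 Q0 powr |e|\<close> allows for an exponent \<open>e\<close> of either sign.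
\<close>

lemma near_points_max_bound:
  fixes A :: "real ^ 'm ^ 'n"
  assumes \<epsilon>: "\<epsilon> > 0"
  shows "\<exists>C>0. \<forall>\<eta> Q \<delta>. Q > 0 \<longrightarrow> \<delta> > 0 \<longrightarrow>
    real (card (near_points A Q \<delta> \<eta>))
      \<le> max (C_const CARD('n) CARD('m) * \<delta> ^ CARD('m) * real Q ^ CARD('n))
          (C * real Q powr (real CARD('n) - real_of_ereal (ereal (real CARD('m)) / dioph_exponent A) + \<epsilon>))"
proof -
  let ?n = "CARD('n)" and ?m = "CARD('m)"
  define s where "s = real_of_ereal (1 / dioph_exponent A)"
  define e where "e = real ?n - real ?m * s + \<epsilon>"
  have s_m: "real_of_ereal (ereal (real ?m) / dioph_exponent A) = ?m * s"
    by (simp add: s_def divide_ereal_def)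
  obtain Q0 where Q0: "Q0 > 0" and bound: "\<And>\<eta> Q \<delta>. real Q \<ge> Q0 \<Longrightarrow> \<delta> \<ge> real Q powr (- s + \<epsilon> / ?m) \<Longrightarrow>
      real (card (near_points A Q \<delta> \<eta>)) \<le> C_const ?n ?m * \<delta> ^ ?m * real Q ^ ?n"
    using near_points_bound[of "\<epsilon> / ?m" A] \<epsilon> unfolding s_def by auto
  define C1 where "C1 = (2 * Q0) ^ ?n * max 1 Q0 powr \<bar>e\<bar>"
  define C where "C = max C1 (C_const ?n ?m)"
  have "C > 0" unfolding C_def C_const_def by (simp add: less_max_iff_disj)
  moreover have "real (card (near_points A Q \<delta> \<eta>))
      \<le> max (C_const ?n ?m * \<delta> ^ ?m * real Q ^ ?n) (C * real Q powr e)"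
    if Q: "Q > 0" and \<delta>: "\<delta> > 0" for \<eta> Q \<delta>
  proof -
    define \<delta>0 where "\<delta>0 = real Q powr (- s + \<epsilon> / ?m)"
    consider "real Q < Q0" | "real Q \<ge> Q0" "\<delta> \<ge> \<delta>0" | "real Q \<ge> Q0" "\<delta> < \<delta>0" by linarith
    then show ?thesis
    proof cases
      case 1
      have "1 = (real Q powr \<bar>e\<bar>) * real Q powr (- \<bar>e\<bar>)"
        using Q by (simp flip: powr_add)
      also have "\<dots> \<le> max 1 Q0 powr \<bar>e\<bar> * real Q powr e"
        using 1 Q by (intro mult_mono powr_mono2 powr_mono) auto
      finally have "(2 * real Q) ^ ?n * 1 \<le> (2 * Q0) ^ ?n * (max 1 Q0 powr \<bar>e\<bar> * real Q powr e)"
        using 1 by (intro mult_mono power_mono) auto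
      then have "(2 * real Q) ^ ?n \<le> C1 * real Q powr e"
        by (simp only: C1_def mult.assoc mult_1_right)
      with card_near_points_le have "real (card (near_points A Q \<delta> \<eta>)) \<le> C1 * real Q powr e"
        by (rule order.trans)
      also have "\<dots> \<le> C * real Q powr e" by (intro mult_right_mono) (auto simp: C_def)
      finally show ?thesis by simp
    next
      case 2
      then show ?thesis using bound[of Q \<delta> \<eta>] by (simp add: \<delta>0_def)
    next
      case 3
      have "near_points A Q \<delta> \<eta> \<subseteq> near_points A Q \<delta>0 \<eta>"
        using 3 by auto
      then have "real (card (near_points A Q \<delta> \<eta>)) \<le> real (card (near_points A Q \<delta>0 \<eta>))"
        by (intro of_nat_mono card_mono finite_near_points)
      also have "\<dots> \<le> C_const ?n ?m * \<delta>0 ^ ?m * real Q ^ ?n"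
        using 3 by (intro bound) (auto simp: \<delta>0_def)
      also have "\<delta>0 ^ ?m * real Q ^ ?n = real Q powr e"
      proof -
        have "\<delta>0 ^ ?m * real Q ^ ?n = real Q powr ((- s + \<epsilon> / ?m) * ?m) * real Q powr ?n"
          using Q by (simp add: \<delta>0_def powr_realpow powr_power mult.commute)
        also have "\<dots> = real Q powr e"
          by (simp add: e_def algebra_simps flip: powr_add)
        finally show ?thesis .
      qed
      then have "C_const ?n ?m * \<delta>0 ^ ?m * real Q ^ ?n = C_const ?n ?m * real Q powr e"
        by (simp add: mult.assoc)
      also have "\<dots> \<le> C * real Q powr e" by (intro mult_right_mono) (auto simp: C_def)
      finally show ?thesis by simp
    qed
  qed
  ultimately show ?thesis unfolding s_m e_def by blast
qed

section \<open>The counting functions of the theorem\<close>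

lemma vec_cons_nth [simp]:
  "vec_cons x v $ None = x" "vec_cons x v $ Some j = v $ j"
  by (simp_all add: vec_cons_def)

lemma sum_option: "(\<Sum>i\<in>(UNIV :: 'd :: finite option set). f i) = f None + (\<Sum>j\<in>UNIV. f (Some j))"
  by (simp add: UNIV_option_conv sum.reindex)

lemma vec_cons_vector_matrix_mult:
  fixes A :: "real ^ 'm ^ ('d :: finite option)"
  shows "vec_cons x v v* A = x *s A $ None + v v* (\<chi> j. A $ Some j)"
  by (simp add: vec_eq_iff vector_matrix_mult_def sum_option)

lemma count_N_eq_card_near_points:
  fixes A :: "real ^ 'm ^ ('d :: finite option)"
  shows "count_N A Q \<delta> \<theta> = card (near_points A Q \<delta> (snd \<theta> - vec_cons 0 (fst \<theta>) v* A))"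
proof -
  have shift: "vec_cons (real_of_int q) (of_int_vec a + fst \<theta>) v* A - snd \<theta>
      = of_int_vec (vec_cons q a) v* A - (snd \<theta> - vec_cons 0 (fst \<theta>) v* A)" for q and a :: "int ^ 'd"
  proof -
    have "vec_cons (real_of_int q) (of_int_vec a + fst \<theta>)
        = of_int_vec (vec_cons q a) + vec_cons 0 (fst \<theta>)"
      by (auto simp: vec_eq_iff vec_cons_def split: option.split)
    then show ?thesis by (simp add: vector_matrix_left_distrib)
  qed
  have split: "vec_cons (x $ None) (\<chi> j. x $ Some j) = x" for x :: "int ^ 'd option"
    by (auto simp: vec_eq_iff vec_cons_def split: option.split)
  show ?thesis
    unfolding count_N_def shift
    by (intro bij_betw_same_card[where f = "\<lambda>(q, a). vec_cons q a"]
          bij_betw_byWitness[where f' = "\<lambda>x. (x $ None, \<chi> j. x $ Some j)"]) (auto simp: split)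
qed

text \<open>The first row of the matrix enters only through the shift \<open>q \<beta>\<close> of the target point, so a
  bound that is uniform in the target bounds the supremum over \<open>q\<close>. The supremum is one of natural
  numbers, hence the detour through the integer part of \<open>c\<close>.\<close>

lemma count_N'_le:
  assumes "\<And>\<eta>. real (card (near_points A' Q \<delta> \<eta>)) \<le> c"
  shows "real (count_N' (vec_cons \<beta> A') Q \<delta> \<theta>) \<le> c"
proof -
  have shift: "vec_cons q (of_int_vec a + fst \<theta>) v* vec_cons \<beta> A' - snd \<theta>
      = of_int_vec a v* A' - (snd \<theta> - q *s \<beta> - fst \<theta> v* A')" for q a
    by (simp add: vec_cons_vector_matrix_mult vector_matrix_left_distrib algebra_simps)
  have eq: "count_N' (vec_cons \<beta> A') Q \<delta> \<theta>
      = (SUP q :: real. card (near_points A' Q \<delta> (snd \<theta> - q *s \<beta> - fst \<theta> v* A')))"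
    unfolding count_N'_def shift ..
  have "card (near_points A' Q \<delta> \<eta>) \<le> nat \<lfloor>c\<rfloor>" for \<eta>
    using assms[of \<eta>] by linarith
  then have "count_N' (vec_cons \<beta> A') Q \<delta> \<theta> \<le> nat \<lfloor>c\<rfloor>"
    unfolding eq by (intro cSUP_least) auto
  moreover have "c \<ge> 0" using assms[of 0] by linarith
  ultimately show ?thesis by linarith
qed

theorem theorem3p2:
  fixes A' :: "real ^ 'm ^ 'd" and \<epsilon> :: real
  assumes "\<epsilon> > 0"
  shows
    "(\<forall>(\<beta> :: real ^ 'm) (\<omega> :: ereal). dioph_exponent (vec_cons \<beta> A') = \<omega> \<longrightarrow>
        (\<exists>Q0 :: real. Q0 > 0 \<and>
          (\<forall>(\<theta> :: (real ^ 'd) \<times> (real ^ 'm)) (Q :: nat) (\<delta> :: real).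
            Q > 0 \<longrightarrow> real Q \<ge> Q0 \<longrightarrow> \<delta> \<ge> real Q powr (- real_of_ereal (1 / \<omega>) + \<epsilon>) \<longrightarrow>
            real (count_N (vec_cons \<beta> A') Q \<delta> \<theta>)
              \<le> C_const (CARD('d) + 1) CARD('m) * \<delta> ^ CARD('m) * real Q ^ (CARD('d) + 1)))
        \<and>
        (\<exists>C :: real. C > 0 \<and>
          (\<forall>(\<theta> :: (real ^ 'd) \<times> (real ^ 'm)) (Q :: nat) (\<delta> :: real).
            Q > 0 \<longrightarrow> \<delta> > 0 \<longrightarrow>
            real (count_N (vec_cons \<beta> A') Q \<delta> \<theta>)
              \<le> max (C_const (CARD('d) + 1) CARD('m) * \<delta> ^ CARD('m) * real Q ^ (CARD('d) + 1))
                    (C * real Q powr (real (CARD('d) + 1)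
                       - real_of_ereal (ereal (real CARD('m)) / \<omega>) + \<epsilon>)))))
     \<and>
     (\<forall>\<omega> :: ereal. dioph_exponent A' = \<omega> \<longrightarrow>
        (\<exists>Q0 :: real. Q0 > 0 \<and>
          (\<forall>(\<beta> :: real ^ 'm) (\<theta> :: (real ^ 'd) \<times> (real ^ 'm)) (Q :: nat) (\<delta> :: real).
            Q > 0 \<longrightarrow> real Q \<ge> Q0 \<longrightarrow> \<delta> \<ge> real Q powr (- real_of_ereal (1 / \<omega>) + \<epsilon>) \<longrightarrow>
            real (count_N' (vec_cons \<beta> A') Q \<delta> \<theta>)
              \<le> C_const CARD('d) CARD('m) * \<delta> ^ CARD('m) * real Q ^ CARD('d))))"
proof (intro conjI allI impI)
  fix \<beta> :: "real ^ 'm" and \<omega> :: ereal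
  assume \<omega>: "dioph_exponent (vec_cons \<beta> A') = \<omega>"
  have card: "CARD('d option) = CARD('d) + 1" by (simp add: card_UNIV_option)
  show "\<exists>Q0>0. \<forall>\<theta> Q \<delta>. Q > 0 \<longrightarrow> Q0 \<le> real Q \<longrightarrow>
      real Q powr (- real_of_ereal (1 / \<omega>) + \<epsilon>) \<le> \<delta> \<longrightarrow>
      real (count_N (vec_cons \<beta> A') Q \<delta> \<theta>)
        \<le> C_const (CARD('d) + 1) CARD('m) * \<delta> ^ CARD('m) * real Q ^ (CARD('d) + 1)"
    using near_points_bound[OF assms, of "vec_cons \<beta> A'"]
    unfolding count_N_eq_card_near_points card \<omega> by blast
  show "\<exists>C>0. \<forall>\<theta> Q \<delta>. Q > 0 \<longrightarrow> \<delta> > 0 \<longrightarrow>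
      real (count_N (vec_cons \<beta> A') Q \<delta> \<theta>)
        \<le> max (C_const (CARD('d) + 1) CARD('m) * \<delta> ^ CARD('m) * real Q ^ (CARD('d) + 1))
              (C * real Q powr (real (CARD('d) + 1)
                - real_of_ereal (ereal (real CARD('m)) / \<omega>) + \<epsilon>))"
    using near_points_max_bound[OF assms, of "vec_cons \<beta> A'"]
    unfolding count_N_eq_card_near_points card \<omega> by blast
next
  fix \<omega> :: ereal
  assume \<omega>: "dioph_exponent A' = \<omega>"
  obtain Q0 where "Q0 > 0" and bound: "\<And>\<eta> Q \<delta>. real Q \<ge> Q0 \<Longrightarrow>
      \<delta> \<ge> real Q powr (- real_of_ereal (1 / \<omega>) + \<epsilon>) \<Longrightarrow>
      real (card (near_points A' Q \<delta> \<eta>)) \<le> C_const CARD('d) CARD('m) * \<delta> ^ CARD('m) * real Q ^ CARD('d)"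
    using near_points_bound[OF assms, of A'] \<omega> by blast
  then show "\<exists>Q0>0. \<forall>\<beta> \<theta> Q \<delta>. Q > 0 \<longrightarrow> Q0 \<le> real Q \<longrightarrow>
      real Q powr (- real_of_ereal (1 / \<omega>) + \<epsilon>) \<le> \<delta> \<longrightarrow>
      real (count_N' (vec_cons \<beta> A') Q \<delta> \<theta>)
        \<le> C_const CARD('d) CARD('m) * \<delta> ^ CARD('m) * real Q ^ CARD('d)"
    by (intro exI[of _ Q0]) (auto intro!: count_N'_le)
qed

end
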